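(* Let $\mu,a,b,\alpha$ be nonzero real constants such that $b\alpha$ has the same sign as $a$, let $k>0$ and $\delta\in\mathbb{R}$, and set $$c=\frac{4ak^2}{\mu},\qquad A^2=\frac{2a}{b\alpha}\,k^2,\qquad A\in\mathbb{R}.$$ Let $$u(x,t)=A\,\operatorname{sech}\bigl(k(x-ct-\delta)\bigr),$$ the one-soliton of the scalar equation $\mu\,u_t+a\,u_{xxx}+6\,b\,\alpha\,u^2u_x=0$. Let $x_0,t_0\in\mathbb{R}$. Then $u$ is shifted-$PT$ symmetric, that is, $$u(x,t)=u(-x+x_0,\,-t+t_0)\qquad\text{for all }(x,t),$$ if and only if $$\delta=\frac{x_0-ct_0}{2}.$$ Consequently, the shifted-$PT$ symmetric one-soliton is $$u_{x_0,t_0}(x,t)=A\,\operatorname{sech}\!\left(k\Bigl(x-ct-\frac{x_0-ct_0}{2}\Bigr)\right).$$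
   Context: All quantities are real, and $\operatorname{sech}(z)=1/\cosh(z)$. *)

theory Defs
  imports Complex_Main
begin

definition sech :: "real \<Rightarrow> real" where
  "sech z = 1 / cosh z"

(* Amplitude A, wave number k, speed c, phase shift \<delta>. The relations tying A and c
   to the coefficients of the evolution equation are not part of the profile. *)
definition one_soliton :: "real \<Rightarrow> real \<Rightarrow> real \<Rightarrow> real \<Rightarrow> real \<Rightarrow> real \<Rightarrow> real" where
  "one_soliton A k c \<delta> x t = A * sech (k * (x - c * t - \<delta>))"

definition shifted_PT_symmetric :: "real \<Rightarrow> real \<Rightarrow> (real \<Rightarrow> real \<Rightarrow> real) \<Rightarrow> bool" where
  "shifted_PT_symmetric x0 t0 u \<longleftrightarrow> (\<forall>x t. u x t = u (- x + x0) (- t + t0))"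

end

theory Submission
  imports Defs
begin

text \<open>The reflection (x, t) to (x0 - x, t0 - t) turns the phase p = x - c t - \<delta> into
  (x0 - c t0 - 2 \<delta>) - p. If the bracket vanishes, p only changes sign and evenness of sech
  (\<open>sech_minus\<close>) gives the symmetry. Conversely, sech takes the value 1 only at 0
  (\<open>sech_eq_1_iff\<close>), so symmetry at a point with p = 0 forces the bracket to
  vanish.\<close>

lemma sech_eq_1_iff: "sech z = 1 \<longleftrightarrow> z = 0"
  by (simp add: sech_def cosh_real_one_iff)

lemma sech_minus: "sech (- z) = sech z"
  by (simp add: sech_def)

lemma shifted_PT_symmetric_one_soliton_iff:
  assumes "A \<noteq> 0" and "k \<noteq> 0"
  shows "shifted_PT_symmetric x0 t0 (one_soliton A k c \<delta>) \<longleftrightarrow> \<delta> = (x0 - c * t0) / 2"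
proof
  assume "shifted_PT_symmetric x0 t0 (one_soliton A k c \<delta>)"
  \<comment> \<open>Compare values at the crest \<open>(\<delta>, 0)\<close>: the reflected point must also lie on the crest.\<close>
  then have "one_soliton A k c \<delta> \<delta> 0 = one_soliton A k c \<delta> (- \<delta> + x0) (- 0 + t0)"
    unfolding shifted_PT_symmetric_def by blast
  \<comment> \<open>The left side is A sech 0; the instance at 0 supplies sech 0 = 1, and A
    cancels.\<close>
  then have "sech (k * (- \<delta> + x0 - c * t0 - \<delta>)) = 1"
    using \<open>A \<noteq> 0\<close> sech_eq_1_iff[of 0] by (simp add: one_soliton_def)
  then have "- \<delta> + x0 - c * t0 - \<delta> = 0"
    unfolding sech_eq_1_iff using \<open>k \<noteq> 0\<close> by (simp only: mult_eq_0_iff simp_thms)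
  then have "2 * \<delta> = x0 - c * t0"
    by algebra
  then show "\<delta> = (x0 - c * t0) / 2"
    by (simp only: nonzero_eq_divide_eq[OF zero_neq_numeral[symmetric]] mult.commute)
next
  assume \<delta>: "\<delta> = (x0 - c * t0) / 2"
  \<comment> \<open>For this \<delta> the reflection negates the phase.\<close>
  have "k * (- x + x0 - c * (- t + t0) - \<delta>) = - (k * (x - c * t - \<delta>))" for x t
    unfolding \<delta> by algebra
  then show "shifted_PT_symmetric x0 t0 (one_soliton A k c \<delta>)"
    by (simp only: shifted_PT_symmetric_def one_soliton_def sech_minus simp_thms)
qed

theorem mainTheorem3:
  fixes \<mu> a b \<alpha> k \<delta> c A x0 t0 :: real
  assumes "\<mu> \<noteq> 0" and "a \<noteq> 0" and "b \<noteq> 0" and "\<alpha> \<noteq> 0"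
    and "sgn (b * \<alpha>) = sgn a"
    and "k > 0"
    and "c = 4 * a * k\<^sup>2 / \<mu>"
    and "A\<^sup>2 = 2 * a / (b * \<alpha>) * k\<^sup>2"
  shows "(shifted_PT_symmetric x0 t0 (one_soliton A k c \<delta>) \<longleftrightarrow> \<delta> = (x0 - c * t0) / 2) \<and>
    {u. (\<exists>\<delta>'. u = one_soliton A k c \<delta>') \<and> shifted_PT_symmetric x0 t0 u} =
      {\<lambda>x t. A * sech (k * (x - c * t - (x0 - c * t0) / 2))}"
proof -
  have "A\<^sup>2 \<noteq> 0"
    using assms by simp
  \<comment> \<open>Kept general in the phase shift d: the set equality needs it for every
    \<delta>', not just for the given \<delta>.\<close>
  then have iff: "shifted_PT_symmetric x0 t0 (one_soliton A k c d) \<longleftrightarrow> d = (x0 - c * t0) / 2" for d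
    using shifted_PT_symmetric_one_soliton_iff \<open>k > 0\<close> by simp
  have "(\<lambda>x t. A * sech (k * (x - c * t - (x0 - c * t0) / 2))) = one_soliton A k c ((x0 - c * t0) / 2)"
    by (intro ext) (simp only: one_soliton_def)
  then show ?thesis
    unfolding iff by (auto simp only: iff)
qed

end
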